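(* Let $p\in[1,\infty]$ and let $b$ be a slowly varying function; if $p=\infty$, assume that $b$ is non-decreasing. Then $$(L^{p,\infty,b})'=L^{p',1,b^{-1}}$$ up to equivalence of the defining functionals.
   Context: $(R,\mu)$ is a $\sigma$-finite non-atomic measure space with $\mu(R)=\infty$; $M=M(R,\mu)$ is the set of extended complex-valued $\mu$-measurable functions on $R$ (identified when equal $\mu$-a.e.). For $f\in M$, $f^*(t)=\inf\{s\ge 0:\mu(\{|f|>s\})\le t\}$. Conventions: $1/\infty=0$; $p'=p/(p-1)$ for $p\in(1,\infty)$, $1'=\infty$, $\infty'=1$; $b^{-1}=1/b$. A measurable $b:(0,\infty)\to(0,\infty)$ is slowly varying if for every $\varepsilon>0$ there are a non-decreasing function $b_\varepsilon$ and a non-increasing function $b_{-\varepsilon}$ with $t^\varepsilon b(t)\approx b_\varepsilon(t)$ and $t^{-\varepsilon}b(t)\approx b_{-\varepsilon}(t)$ on $(0,\infty)$, where $\approx$ denotes two-sided estimate up to positive finite multiplicative constants. For $f\in M$ and $p,q\in(0,\infty]$, $\lVert f\rVert_{p,q,b}=\lVert t^{1/p-1/q}b(t)f^*(t)\rVert_q$, where $\lVert\cdot\rVert_q$ is the Lebesgue $L^q$ (quasi)norm over $(0,\infty)$ in the variable $t$, and $L^{p,q,b}=\{f\in M:\lVert f\rVert_{p,q,b}<\infty\}$. The associate space of a space $X=\{f\in M:\lVert f\rVert_X<\infty\}$ is $X'=\{f\in M:\lVert f\rVert_{X'}<\infty\}$, where $\lVert f\rVert_{X'}=\sup\{\int_R|fg|\,d\mu: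 g\in M,\ \lVert g\rVert_X\le1\}$. Equality of spaces up to equivalence of the defining functionals means that the sets coincide and the functionals are bounded by constant multiples of each other. *)

theory Defs
  imports "HOL-Analysis.Analysis" "HOL-Probability.Essential_Supremum"
begin

text \<open>The extended complex plane is the one-point compactification of the complex numbers; the
  point at infinity is \<^term>\<open>None\<close>. Functions that agree almost everywhere are not identified
  formally: every functional below depends on the function only up to null sets.\<close>

type_synonym ecomplex = "complex option"

definition ecomplex_borel :: "ecomplex measure" where
  "ecomplex_borel =
     sigma UNIV {U. openin (Alexandroff_compactification (euclidean :: complex topology)) U}"

fun ecmod :: "ecomplex \<Rightarrow> ennreal" where
  "ecmod (Some z) = ennreal (cmod z)"
| "ecmod None = \<infinity>"

text \<open>As usual in integration theory, \<open>0 \<cdot> \<infinity> = 0\<close>.\<close>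

fun ectimes :: "ecomplex \<Rightarrow> ecomplex \<Rightarrow> ecomplex" where
  "ectimes (Some z) (Some w) = Some (z * w)"
| "ectimes None w = (if w = Some 0 then Some 0 else None)"
| "ectimes z None = (if z = Some 0 then Some 0 else None)"

definition mfuns :: "'a measure \<Rightarrow> ('a \<Rightarrow> ecomplex) set" where
  "mfuns M = measurable M ecomplex_borel"

definition nonatomic :: "'a measure \<Rightarrow> bool" where
  "nonatomic M \<longleftrightarrow>
     (\<forall>A\<in>sets M. 0 < emeasure M A \<longrightarrow>
        (\<exists>B\<in>sets M. B \<subseteq> A \<and> 0 < emeasure M B \<and> emeasure M B < emeasure M A))"

definition rearrangement :: "'a measure \<Rightarrow> ('a \<Rightarrow> ecomplex) \<Rightarrow> real \<Rightarrow> ennreal" where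
  "rearrangement M f t =
     Inf {ennreal s | s. 0 \<le> s \<and> emeasure M {x \<in> space M. ennreal s < ecmod (f x)} \<le> ennreal t}"

text \<open>Functions on \<open>(0,\<infinity>)\<close> are total functions on the reals whose values outside
  \<^term>\<open>{0<..} :: real set\<close> are irrelevant.\<close>

definition approx_on_pos :: "(real \<Rightarrow> real) \<Rightarrow> (real \<Rightarrow> real) \<Rightarrow> bool" where
  "approx_on_pos f g \<longleftrightarrow> (\<exists>c>0. \<exists>C>0. \<forall>t>0. c * g t \<le> f t \<and> f t \<le> C * g t)"

definition slowly_varying :: "(real \<Rightarrow> real) \<Rightarrow> bool" where
  "slowly_varying b \<longleftrightarrow>
     b \<in> borel_measurable (lebesgue_on {0<..}) \<and>
     (\<forall>t>0. 0 < b t) \<and>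
     (\<forall>\<epsilon>>0. (\<exists>u. mono_on {0<..} u \<and> approx_on_pos (\<lambda>t. t powr \<epsilon> * b t) u) \<and>
             (\<exists>v. antimono_on {0<..} v \<and> approx_on_pos (\<lambda>t. t powr (- \<epsilon>) * b t) v))"

text \<open>Extension of \<open>x powr r\<close> to \<open>x = \<infinity>\<close>, meant for \<open>r > 0\<close>.\<close>

definition ennreal_powr :: "ennreal \<Rightarrow> real \<Rightarrow> ennreal" where
  "ennreal_powr x r = (if x = \<infinity> then \<infinity> else ennreal (enn2real x powr r))"

definition Lq_norm :: "ennreal \<Rightarrow> (real \<Rightarrow> ennreal) \<Rightarrow> ennreal" where
  "Lq_norm q h =
     (if q = \<infinity> then esssup (lebesgue_on {0<..}) h
      else ennreal_powr (\<integral>\<^sup>+ t. ennreal_powr (h t) (enn2real q) \<partial>lebesgue_on {0<..})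
             (enn2real (1 / q)))"

text \<open>The exponents \<open>p\<close> and \<open>q\<close> range over \<open>(0,\<infinity>]\<close>; in \<^typ>\<open>ennreal\<close> one has
  \<open>1 / \<infinity> = 0\<close>, so \<^term>\<open>enn2real (1 / p)\<close> is the usual real number \<open>1/p\<close>.\<close>

definition LK_norm ::
  "'a measure \<Rightarrow> ennreal \<Rightarrow> ennreal \<Rightarrow> (real \<Rightarrow> real) \<Rightarrow> ('a \<Rightarrow> ecomplex) \<Rightarrow> ennreal" where
  "LK_norm M p q b f =
     Lq_norm q (\<lambda>t. ennreal (t powr (enn2real (1 / p) - enn2real (1 / q)) * b t)
                      * rearrangement M f t)"

definition conj_exponent :: "ennreal \<Rightarrow> ennreal" where
  "conj_exponent p = (if p = 1 then \<infinity> else if p = \<infinity> then 1 else p / (p - 1))"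

definition space_of ::
  "'a measure \<Rightarrow> (('a \<Rightarrow> ecomplex) \<Rightarrow> ennreal) \<Rightarrow> ('a \<Rightarrow> ecomplex) set" where
  "space_of M N = {f \<in> mfuns M. N f < \<infinity>}"

definition associate_norm ::
  "'a measure \<Rightarrow> (('a \<Rightarrow> ecomplex) \<Rightarrow> ennreal) \<Rightarrow> ('a \<Rightarrow> ecomplex) \<Rightarrow> ennreal" where
  "associate_norm M N f =
     (SUP g\<in>{g \<in> mfuns M. N g \<le> 1}. \<integral>\<^sup>+ x. ecmod (ectimes (f x) (g x)) \<partial>M)"

definition equivalent_spaces ::
  "'a measure \<Rightarrow> (('a \<Rightarrow> ecomplex) \<Rightarrow> ennreal) \<Rightarrow> (('a \<Rightarrow> ecomplex) \<Rightarrow> ennreal) \<Rightarrow> bool" where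
  "equivalent_spaces M N1 N2 \<longleftrightarrow>
     space_of M N1 = space_of M N2 \<and>
     (\<exists>C>0. \<forall>f\<in>mfuns M. N1 f \<le> ennreal C * N2 f \<and> N2 f \<le> ennreal C * N1 f)"

end

theory Submission
  imports Defs
begin

text \<open>Put \<open>\<phi> t = t powr (1 / p) * b t\<close>, so that the two norms in question are the essential supremum of
  \<open>\<phi> g*\<close> and the integral of \<open>f* / \<phi>\<close>. The Hardy-Littlewood inequality bounds the integral of
  \<open>|f g|\<close> by that of \<open>f* g*\<close>, hence by that of \<open>f* / \<phi>\<close> if \<open>\<phi> g* \<le> 1\<close>. Conversely, \<open>1 / \<phi>\<close> is
  equivalent to a non-increasing function \<open>\<psi>\<close>: by slow variation if \<open>p < \<infinity>\<close>, by the monotonicity of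
  \<open>b\<close> if \<open>p = \<infinity>\<close>. As the measure is non-atomic, there are nested sets of measure \<open>a * 2 ^ j\<close> on
  which \<open>|f|\<close> is at least about \<open>f* (a * 2 ^ j)\<close>, and the function that jumps down along \<open>\<psi>\<close> on
  these sets almost attains the integral of \<open>f* \<psi>\<close> over \<open>{2 * a..}\<close>; then \<open>a\<close> tends to 0.\<close>

section \<open>Non-atomic measures\<close>

text \<open>A strictly smaller subset of \<open>A\<close> has finite measure, even if
  \<open>A\<close> has not. Splitting a set of finite measure into two parts of positive measure
  leaves one part with at most half of it, and repeated halving gets below \<open>e\<close>.\<close>

lemma nonatomic_subset_small:
  assumes "nonatomic M" and A: "A \<in> sets M" "0 < emeasure M A" and e: "0 < (e::real)"
  shows "\<exists>B\<in>sets M. B \<subseteq> A \<and> 0 < emeasure M B \<and> emeasure M B \<le> ennreal e"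
proof -
  have halve: "\<exists>C\<in>sets M. C \<subseteq> B \<and> 0 < emeasure M C \<and> emeasure M C < emeasure M B"
    if "B \<in> sets M" "0 < emeasure M B" for B
    using assms(1) that by (auto simp: nonatomic_def)
  obtain A0 where A0: "A0 \<in> sets M" "A0 \<subseteq> A" "0 < emeasure M A0" "emeasure M A0 < emeasure M A"
    using halve[OF A] by blast
  then have fin0: "emeasure M A0 < \<infinity>"
    by (simp add: order_less_le_trans top_greatest)
  define m where "m = measure M A0"
  have ind: "\<exists>B\<in>sets M. B \<subseteq> A0 \<and> 0 < emeasure M B \<and> emeasure M B \<le> ennreal (m / 2 ^ n)" for n
  proof (induction n)
    case 0
    show ?case
      using A0 fin0 by (intro bexI[of _ A0]) (auto simp: m_def emeasure_eq_ennreal_measure)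
  next
    case (Suc n)
    then obtain B where B: "B \<in> sets M" "B \<subseteq> A0" "0 < emeasure M B"
      "emeasure M B \<le> ennreal (m / 2 ^ n)" by blast
    obtain C where C: "C \<in> sets M" "C \<subseteq> B" "0 < emeasure M C" "emeasure M C < emeasure M B"
      using halve[OF B(1,3)] by blast
    have finB: "emeasure M B < \<infinity>" using le_less_trans[OF B(4) ennreal_less_top] by simp
    have finC: "emeasure M C \<noteq> \<infinity>" using C finB by auto
    have finD: "emeasure M (B - C) \<noteq> \<infinity>"
      using le_less_trans[OF emeasure_mono[of "B - C" B M] finB] B by auto
    have sum: "measure M C + measure M (B - C) = measure M B"
      using measure_Diff[of M B C] finB B C by (auto simp: fmeasurable_def)
    have mB: "measure M B \<le> m / 2 ^ n"
      using B(4) by (auto simp: measure_def m_def intro!: enn2real_leI)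
    have eC: "emeasure M C = ennreal (measure M C)" and eD: "emeasure M (B - C) = ennreal (measure M (B - C))"
      and eB: "emeasure M B = ennreal (measure M B)"
      using finC finD finB by (auto simp: emeasure_eq_ennreal_measure)
    have D: "0 < emeasure M (B - C)"
      using C sum eC eB eD by (auto simp: ennreal_less_iff)
    have "measure M C \<le> m / 2 ^ Suc n \<or> measure M (B - C) \<le> m / 2 ^ Suc n"
    proof -
      define q where "q = m / 2 ^ n"
      have "m / 2 ^ Suc n = q / 2" by (simp add: q_def)
      then show ?thesis using sum mB unfolding q_def[symmetric] by (simp only:) arith
    qed
    then show ?case
    proof
      assume "measure M C \<le> m / 2 ^ Suc n"
      then show ?thesis using C B by (intro bexI[of _ C]) (auto simp: eC intro!: ennreal_leI)
    next
      assume "measure M (B - C) \<le> m / 2 ^ Suc n"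
      then show ?thesis using C B D by (intro bexI[of _ "B - C"]) (auto simp: eD intro!: ennreal_leI)
    qed
  qed
  obtain n where "m / e < 2 ^ n"
    using real_arch_pow[of 2 "m / e"] by auto
  then have "m / 2 ^ n \<le> e" using e by (simp add: field_simps)
  moreover obtain B where "B \<in> sets M" "B \<subseteq> A0" "0 < emeasure M B" "emeasure M B \<le> ennreal (m / 2 ^ n)"
    using ind[of n] by blast
  ultimately show ?thesis using A0(2)
    by (meson ennreal_leI order_trans)
qed

text \<open>Sierpinski's theorem, by greedy exhaustion: each step captures at least half of what
  could still be added, so whatever is left over is null.\<close>

lemma nonatomic_subset_measure_eq:
  assumes na: "nonatomic M" and B: "B \<in> sets M" "ennreal c \<le> emeasure M B" and c: "0 \<le> c"
  shows "\<exists>A\<in>sets M. A \<subseteq> B \<and> emeasure M A = ennreal c"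
proof -
  \<comment> \<open>\<open>cand F\<close> holds the sets whose measure still fits on top of that of
    \<open>F\<close>. \<open>Q\<close> asks only for half of the best possible gain, because the
    supremum of the gains need not be attained.\<close>
  define cand where
    "cand F = {H \<in> sets M. H \<subseteq> B - F \<and> emeasure M F + emeasure M H \<le> ennreal c}" for F
  define P where "P F \<longleftrightarrow> F \<in> sets M \<and> F \<subseteq> B \<and> emeasure M F \<le> ennreal c" for F
  define Q where "Q F F' \<longleftrightarrow> F \<subseteq> F' \<and>
    (\<forall>H\<in>cand F. emeasure M F + emeasure M H / 2 \<le> emeasure M F')" for F F'
  have step: "\<exists>F'. P F' \<and> Q F F'" if F: "P F" for F
  proof -
    define S where "S = (SUP H\<in>cand F. emeasure M H)"
    have "S \<le> ennreal c"
      unfolding S_def cand_def by (intro SUP_least) (auto elim: order_trans[rotated])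
    then have S: "S < top" using ennreal_less_top le_less_trans by blast
    have up: "emeasure M H \<le> S" if "H \<in> cand F" for H
      unfolding S_def using that by (rule SUP_upper)
    show ?thesis
    proof (cases "S = 0")
      case True
      then have "\<forall>H\<in>cand F. emeasure M H = 0" using up by auto
      then show ?thesis using F by (intro exI[of _ F]) (auto simp: Q_def)
    next
      case False
      have "S / 2 < S"
        using S False by (cases S) (auto simp: divide_ennreal ennreal_less_iff simp flip: ennreal_numeral)
      then obtain H where H: "H \<in> cand F" "S / 2 < emeasure M H"
        unfolding S_def less_SUP_iff by blast
      have eq: "emeasure M (F \<union> H) = emeasure M F + emeasure M H"
        using H F by (intro plus_emeasure[symmetric]) (auto simp: cand_def P_def)
      have "emeasure M F + emeasure M G / 2 \<le> emeasure M (F \<union> H)" if "G \<in> cand F" for G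
        unfolding eq using up[OF that] H(2)
        by (meson add_left_mono divide_right_mono_ennreal less_imp_le order_trans)
      then show ?thesis using H F eq
        by (intro exI[of _ "F \<union> H"]) (auto simp: P_def Q_def cand_def)
    qed
  qed
  have "P {}" by (simp add: P_def)
  then obtain F where PF: "\<And>n. P (F n)" and QF: "\<And>n. Q (F n) (F (Suc n))"
    using dependent_nat_choice[of "\<lambda>_. P" "\<lambda>_. Q"] step by blast
  have inc: "incseq F" using QF by (auto intro!: incseq_SucI simp: Q_def)
  define A where "A = (\<Union>n. F n)"
  have sF: "F n \<in> sets M" for n using PF by (auto simp: P_def)
  have A: "A \<in> sets M" "A \<subseteq> B" using PF by (auto simp: A_def P_def)
  have emA: "emeasure M A = (SUP n. emeasure M (F n))"
    unfolding A_def by (intro SUP_emeasure_incseq[symmetric]) (use sF inc in auto)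
  have le: "emeasure M A \<le> ennreal c"
    unfolding emA by (intro SUP_least) (use PF in \<open>auto simp: P_def\<close>)
  have "emeasure M A = ennreal c"
  proof (rule ccontr)
    assume "emeasure M A \<noteq> ennreal c"
    with le have less: "emeasure M A < ennreal c" by simp
    then have finA: "emeasure M A < top" using ennreal_less_top less_trans by blast
    define r where "r = measure M A"
    have r: "emeasure M A = ennreal r" "0 \<le> r"
      using finA by (auto simp: r_def emeasure_eq_ennreal_measure)
    then have rc: "r < c" using less c by (simp add: ennreal_less_iff)
    have "emeasure M (B - A) \<noteq> 0"
    proof
      assume "emeasure M (B - A) = 0"
      then have "emeasure M B \<le> emeasure M A"
        using emeasure_subadditive[of A M "B - A"] A B by (simp add: Un_absorb1)
      then show False using less B by auto
    qed
    then obtain H where H: "H \<in> sets M" "H \<subseteq> B - A" "0 < emeasure M H" "emeasure M H \<le> ennreal (c - r)"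
      using nonatomic_subset_small[OF na, of "B - A" "c - r"] A B rc
      by (auto simp: zero_less_iff_neq_zero)
    \<comment> \<open>\<open>H\<close> avoids all of \<open>A\<close> and fits into the remaining
      room \<open>c - r\<close>, so it is a candidate at every stage. Each stage then gains at least
      half of its positive measure, which the finite bound \<open>c\<close> forbids.\<close>
    have cand: "H \<in> cand (F n)" for n
    proof -
      have "emeasure M (F n) \<le> emeasure M A" unfolding emA by (rule SUP_upper) auto
      then have "emeasure M (F n) + emeasure M H \<le> ennreal r + ennreal (c - r)"
        using H r by (intro add_mono) auto
      also have "\<dots> = ennreal c" using r rc by (simp flip: ennreal_plus)
      finally show ?thesis using H by (auto simp: cand_def A_def)
    qed
    have "of_nat n * (emeasure M H / 2) \<le> emeasure M (F n)" for n
    proof (induction n)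
      case (Suc n)
      have "of_nat (Suc n) * (emeasure M H / 2) = of_nat n * (emeasure M H / 2) + emeasure M H / 2"
        by (simp add: distrib_right add.commute)
      also have "\<dots> \<le> emeasure M (F n) + emeasure M H / 2"
        using Suc by (intro add_right_mono)
      also have "\<dots> \<le> emeasure M (F (Suc n))" using QF[of n] cand[of n] by (auto simp: Q_def)
      finally show ?case .
    qed simp
    then have bound: "of_nat n * (emeasure M H / 2) \<le> ennreal c" for n
      using PF[of n] by (meson P_def order_trans)
    have "emeasure M H < top" using H(4) ennreal_less_top le_less_trans by blast
    then obtain h where h: "emeasure M H = ennreal h" "0 < h"
      using H(3) by (cases "emeasure M H") auto
    obtain n :: nat where "c / (h / 2) < n" using reals_Archimedean2 by blast
    then have "c < n * (h / 2)" using h by (simp add: field_simps)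
    moreover have "of_nat n * (emeasure M H / 2) = ennreal (n * (h / 2))"
      using h by (simp add: ennreal_of_nat_eq_real_of_nat divide_ennreal ennreal_mult[symmetric] flip: ennreal_numeral)
    ultimately show False using bound[of n] c by (simp add: ennreal_le_iff2 not_le)
  qed
  then show ?thesis using A by blast
qed

text \<open>Sets chosen separately need not be nested. So \<open>A (Suc j)\<close> arises from
  \<open>A j\<close> by adding a set of measure \<open>s (Suc j) - s j\<close> taken from
  \<open>B (Suc j)\<close> outside \<open>A j\<close>; there is enough room because
  \<open>A j\<close> has finite measure \<open>s j\<close>.\<close>

lemma nonatomic_subset_chain:
  fixes s :: "nat \<Rightarrow> real"
  assumes na: "nonatomic M" and B: "\<And>j. B j \<in> sets M" "incseq B" "\<And>j. ennreal (s j) \<le> emeasure M (B j)"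
    and s: "incseq s" "\<And>j. 0 \<le> s j"
  shows "\<exists>A. (\<forall>j. A j \<in> sets M \<and> A j \<subseteq> B j \<and> emeasure M (A j) = ennreal (s j)) \<and> incseq A"
proof -
  define P where "P j X \<longleftrightarrow> X \<in> sets M \<and> X \<subseteq> B j \<and> emeasure M X = ennreal (s j)" for j X
  have base: "\<exists>X. P 0 X"
    using nonatomic_subset_measure_eq[OF na B(1,3) s(2)] by (auto simp: P_def)
  have step: "\<exists>Y. P (Suc j) Y \<and> X \<subseteq> Y" if X: "P j X" for j X
  proof -
    have sub: "X \<subseteq> B (Suc j)" using X incseq_SucD[OF B(2), of j] by (auto simp: P_def)
    have le: "s j \<le> s (Suc j)" using s(1) by (rule incseq_SucD)
    have "emeasure M (B (Suc j) - X) = emeasure M (B (Suc j)) - ennreal (s j)"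
      using X sub B by (subst emeasure_Diff) (auto simp: P_def)
    also have "\<dots> \<ge> ennreal (s (Suc j)) - ennreal (s j)"
      using B(3) by (rule ennreal_minus_mono) simp
    finally have "ennreal (s (Suc j) - s j) \<le> emeasure M (B (Suc j) - X)"
      using s(2) by (simp add: ennreal_minus)
    then obtain Y where Y: "Y \<in> sets M" "Y \<subseteq> B (Suc j) - X" "emeasure M Y = ennreal (s (Suc j) - s j)"
      using nonatomic_subset_measure_eq[OF na, of "B (Suc j) - X" "s (Suc j) - s j"] X B le
      by (auto simp: P_def)
    have "emeasure M (X \<union> Y) = emeasure M X + emeasure M Y"
      using X Y by (intro plus_emeasure[symmetric]) (auto simp: P_def)
    also have "\<dots> = ennreal (s (Suc j))"
      using X Y le s(2) by (simp add: P_def flip: ennreal_plus)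
    finally show ?thesis
      using X Y sub by (intro exI[of _ "X \<union> Y"]) (auto simp: P_def)
  qed
  obtain A where "\<forall>j. P j (A j) \<and> A j \<subseteq> A (Suc j)"
    using dependent_nat_choice[of P "\<lambda>_ X Y. X \<subseteq> Y", OF base step] by auto
  then show ?thesis
    by (intro exI[of _ A]) (auto simp: P_def intro!: incseq_SucI)
qed

section \<open>Non-increasing rearrangements\<close>

text \<open>Both products follow the convention that zero times infinity is zero.\<close>

lemma ecmod_ectimes: "ecmod (ectimes z w) = ecmod z * ecmod w"
  by (cases z; cases w) (auto simp: norm_mult ennreal_mult ennreal_top_mult ennreal_mult_top)

lemma sets_ecomplex_borel_openin:
  "openin (Alexandroff_compactification (euclidean :: complex topology)) U \<Longrightarrow> U \<in> sets ecomplex_borel"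
  by (simp add: ecomplex_borel_def)

lemma measurable_ecmod: "ecmod \<in> borel_measurable ecomplex_borel"
proof (rule borel_measurableI_greater)
  fix y :: ennreal
  have sp: "space ecomplex_borel = UNIV" by (simp add: ecomplex_borel_def)
  show "{z \<in> space ecomplex_borel. y < ecmod z} \<in> sets ecomplex_borel"
  proof (cases y)
    case (real r)
    \<comment> \<open>The superlevel set is the point at infinity together with the complement of a
      compact ball, hence an open neighbourhood of infinity.\<close>
    have "{z \<in> space ecomplex_borel. y < ecmod z} = insert None (Some ` (UNIV - cball 0 r))"
    proof (intro set_eqI)
      fix z show "z \<in> {z \<in> space ecomplex_borel. y < ecmod z} \<longleftrightarrow> z \<in> insert None (Some ` (UNIV - cball 0 r))"
        using real by (cases z) (auto simp: sp ennreal_less_iff)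
    qed
    moreover have "openin (Alexandroff_compactification (euclidean :: complex topology))
        (insert None (Some ` (UNIV - cball 0 r)))"
      by (auto simp: openin_Alexandroff_compactification intro!: exI[of _ "cball 0 r"])
    ultimately show ?thesis by (simp add: sets_ecomplex_borel_openin)
  qed simp
qed

lemma measurable_Some_ecomplex: "Some \<in> measurable borel ecomplex_borel"
  unfolding ecomplex_borel_def
proof (rule measurable_measure_of)
  fix U assume "U \<in> {U. openin (Alexandroff_compactification (euclidean :: complex topology)) U}"
  then have "openin euclidean {z \<in> topspace (euclidean :: complex topology). Some z \<in> U}"
    using continuous_map_Some openin_continuous_map_preimage by blast
  then show "Some -` U \<inter> space borel \<in> sets borel"
    by (simp add: vimage_def)
qed auto

lemma measurable_ecmod_mfuns: "f \<in> mfuns M \<Longrightarrow> (\<lambda>x. ecmod (f x)) \<in> borel_measurable M"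
  unfolding mfuns_def by (rule measurable_compose[OF _ measurable_ecmod])

section \<open>Level sets and monotonicity of the rearrangement\<close>

lemma rearrangement_le:
  assumes "0 \<le> s" "emeasure M {x \<in> space M. ennreal s < ecmod (f x)} \<le> ennreal t"
  shows "rearrangement M f t \<le> ennreal s"
  unfolding rearrangement_def using assms by (intro Inf_lower) auto

lemma emeasure_gt_if_less_rearrangement:
  assumes "y < rearrangement M f t"
  shows "ennreal t < emeasure M {x \<in> space M. y < ecmod (f x)}"
proof -
  have "y < top" using assms by (simp add: order_less_le_trans)
  then obtain s where "y = ennreal s" "0 \<le> s" by (cases y) auto
  then show ?thesis using rearrangement_le[of s M f t] assms by (meson leD leI)
qed

lemma le_rearrangement:
  assumes f: "f \<in> mfuns M" and t: "ennreal t < emeasure M {x \<in> space M. ennreal s < ecmod (f x)}"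
  shows "ennreal s \<le> rearrangement M f t"
  unfolding rearrangement_def
proof (rule Inf_greatest)
  note [measurable] = measurable_ecmod_mfuns[OF f]
  fix z assume "z \<in> {ennreal s |s. 0 \<le> s \<and> emeasure M {x \<in> space M. ennreal s < ecmod (f x)} \<le> ennreal t}"
  then obtain r where z: "z = ennreal r"
    and r: "emeasure M {x \<in> space M. ennreal r < ecmod (f x)} \<le> ennreal t" by blast
  show "ennreal s \<le> z" unfolding z
  proof (rule ccontr)
    assume "\<not> ennreal s \<le> ennreal r"
    then have "emeasure M {x \<in> space M. ennreal s < ecmod (f x)} \<le> emeasure M {x \<in> space M. ennreal r < ecmod (f x)}"
      by (intro emeasure_mono) auto
    with r t show False by auto
  qed
qed

lemma rearrangement_antimono: "s \<le> t \<Longrightarrow> rearrangement M f t \<le> rearrangement M f s"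
  unfolding rearrangement_def
  by (intro Inf_superset_mono Collect_mono) (blast intro: order_trans ennreal_leI)

lemma measurable_rearrangement [measurable]: "rearrangement M f \<in> borel_measurable borel"
proof (rule borel_measurableI_greater)
  fix y
  have "is_interval {t. y < rearrangement M f t}"
    unfolding is_interval_1 using rearrangement_antimono[of _ _ M f] by (auto intro: less_le_trans)
  then show "{t \<in> space borel. y < rearrangement M f t} \<in> sets borel"
    by (simp add: real_interval_borel_measurable)
qed

section \<open>Layer-cake formula and the Hardy-Littlewood inequality\<close>

text \<open>The strict form serves for the moduli and for measures of level sets, the non-strict
  form for rearrangements, since \<open>le_rearrangement\<close> yields a non-strict bound.\<close>

lemma layer_cake:
  "(\<integral>\<^sup>+ s. indicator {s. 0 < s \<and> ennreal s < a} s \<partial>lborel) = a"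
  "(\<integral>\<^sup>+ s. indicator {s. 0 < s \<and> ennreal s \<le> a} s \<partial>lborel) = a"
proof -
  have "(\<integral>\<^sup>+ s. indicator {s. 0 < s \<and> ennreal s < a} s \<partial>lborel) = a \<and>
        (\<integral>\<^sup>+ s. indicator {s. 0 < s \<and> ennreal s \<le> a} s \<partial>lborel) = a"
  proof (cases a)
    case (real r)
    have "{s. 0 < s \<and> ennreal s < a} = {0<..<r}" "{s. 0 < s \<and> ennreal s \<le> a} = {0<..r}"
      using real by (auto simp: ennreal_less_iff ennreal_le_iff2)
    then show ?thesis using real by simp
  next
    case top
    have "emeasure lborel {0::real<..} = \<infinity>"
    proof (rule ccontr)
      assume "emeasure lborel {0::real<..} \<noteq> \<infinity>"
      then obtain r where r: "emeasure lborel {0::real<..} = ennreal r" "0 \<le> r"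
        by (cases "emeasure lborel {0::real<..}") auto
      have "emeasure lborel {0<..r + 1} \<le> emeasure lborel {0::real<..}"
        by (rule emeasure_mono) auto
      then show False using r by simp
    qed
    moreover have "{s::real. 0 < s \<and> ennreal s < top} = {0<..}" "{s::real. 0 < s \<and> ennreal s \<le> top} = {0<..}"
      by auto
    ultimately show ?thesis using top by simp
  qed
  then show "(\<integral>\<^sup>+ s. indicator {s. 0 < s \<and> ennreal s < a} s \<partial>lborel) = a"
    "(\<integral>\<^sup>+ s. indicator {s. 0 < s \<and> ennreal s \<le> a} s \<partial>lborel) = a" by auto
qed

lemma nn_integral_lborel_prod_times:
  fixes u v :: "real \<Rightarrow> ennreal"
  assumes [measurable]: "u \<in> borel_measurable borel" "v \<in> borel_measurable borel"
  shows "(\<integral>\<^sup>+ z. u (fst z) * v (snd z) \<partial>(lborel \<Otimes>\<^sub>M lborel)) =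
    (\<integral>\<^sup>+ x. u x \<partial>lborel) * (\<integral>\<^sup>+ y. v y \<partial>lborel)"
proof -
  have "(\<integral>\<^sup>+ z. u (fst z) * v (snd z) \<partial>(lborel \<Otimes>\<^sub>M lborel)) = (\<integral>\<^sup>+ x. \<integral>\<^sup>+ y. u x * v y \<partial>lborel \<partial>lborel)"
    by (subst lborel.nn_integral_fst[symmetric]) auto
  also have "\<dots> = (\<integral>\<^sup>+ x. u x \<partial>lborel) * (\<integral>\<^sup>+ y. v y \<partial>lborel)"
    by (simp add: nn_integral_cmult nn_integral_multc)
  finally show ?thesis .
qed

text \<open>Layer-cake representation of both factors; the inequality is
  \<open>\<mu>(A \<inter> B) \<le> min (\<mu> A) (\<mu> B)\<close> for level sets \<open>A\<close> of \<open>f\<close> and \<open>B\<close> of \<open>g\<close>.\<close>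

lemma Hardy_Littlewood_inequality:
  assumes sf: "sigma_finite_measure M" and f: "f \<in> mfuns M" and g: "g \<in> mfuns M"
  shows "(\<integral>\<^sup>+ x. ecmod (f x) * ecmod (g x) \<partial>M) \<le>
    (\<integral>\<^sup>+ t. indicator {0<..} t * (rearrangement M f t * rearrangement M g t) \<partial>lborel)"
proof -
  interpret sigma_finite_measure M by (rule sf)
  interpret L2: sigma_finite_measure "lborel \<Otimes>\<^sub>M lborel :: (real \<times> real) measure"
    unfolding lborel_prod ..
  \<comment> \<open>Two exchanges of integrals follow: of \<open>M\<close> with the plane of pairs
    of levels, where sigma-finiteness of \<open>M\<close> enters, and of the real line, on which the
    rearrangements live, with this plane.\<close>
  interpret MP: pair_sigma_finite M "lborel \<Otimes>\<^sub>M lborel :: (real \<times> real) measure" ..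
  interpret LP: pair_sigma_finite "lborel :: real measure" "lborel \<Otimes>\<^sub>M lborel :: (real \<times> real) measure" ..
  define F G where "F = (\<lambda>x. ecmod (f x))" and "G = (\<lambda>x. ecmod (g x))"
  have [measurable]: "F \<in> borel_measurable M" "G \<in> borel_measurable M"
    using measurable_ecmod_mfuns[OF f] measurable_ecmod_mfuns[OF g] by (simp_all add: F_def G_def)
  define lev where "lev h s = {x \<in> space M. ennreal s < (h x :: ennreal)}" for h s
  define K where "K a s = (indicator {s. 0 < s \<and> ennreal s < a} s :: ennreal)" for a s
  define L where "L a s = (indicator {s. 0 < s \<and> ennreal s \<le> a} s :: ennreal)" for a s
  have K_eq: "K a s = (if 0 < s \<and> ennreal s < a then 1 else 0)" for a s by (simp add: K_def)
  have L_eq: "L a s = (if 0 < s \<and> ennreal s \<le> a then 1 else 0)" for a s by (simp add: L_def)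
  have K: "(\<integral>\<^sup>+ s. K a s \<partial>lborel) = a" and L: "(\<integral>\<^sup>+ s. L a s \<partial>lborel) = a" for a
    using layer_cake[of a] by (simp_all add: K_def L_def)
  have [measurable]: "K a \<in> borel_measurable borel" "L a \<in> borel_measurable borel" for a
    unfolding K_eq L_eq by measurable
  have "(\<integral>\<^sup>+ x. ecmod (f x) * ecmod (g x) \<partial>M) =
      (\<integral>\<^sup>+ x. \<integral>\<^sup>+ z. K (F x) (fst z) * K (G x) (snd z) \<partial>(lborel \<Otimes>\<^sub>M lborel) \<partial>M)"
    by (subst nn_integral_lborel_prod_times) (auto simp: K F_def G_def)
  also have "\<dots> = (\<integral>\<^sup>+ z. \<integral>\<^sup>+ x. K (F x) (fst z) * K (G x) (snd z) \<partial>M \<partial>(lborel \<Otimes>\<^sub>M lborel))"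
    unfolding K_eq by (intro MP.Fubini'[symmetric]) measurable
  also have "\<dots> \<le> (\<integral>\<^sup>+ z. \<integral>\<^sup>+ t. indicator {0<..} t * (L (rearrangement M f t) (fst z) * L (rearrangement M g t) (snd z)) \<partial>lborel
       \<partial>(lborel \<Otimes>\<^sub>M lborel))"
  proof (rule nn_integral_mono)
    fix z :: "real \<times> real"
    obtain s r where z: "z = (s, r)" by (cases z)
    show "(\<integral>\<^sup>+ x. K (F x) (fst z) * K (G x) (snd z) \<partial>M) \<le>
      (\<integral>\<^sup>+ t. indicator {0<..} t * (L (rearrangement M f t) (fst z) * L (rearrangement M g t) (snd z)) \<partial>lborel)"
    proof (cases "0 < s \<and> 0 < r")
      case True
      have "(\<integral>\<^sup>+ x. K (F x) (fst z) * K (G x) (snd z) \<partial>M) =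
          (\<integral>\<^sup>+ x. indicator (lev F s \<inter> lev G r) x \<partial>M)"
        using True by (intro nn_integral_cong) (auto simp: K_eq z lev_def indicator_def)
      also have "\<dots> = emeasure M (lev F s \<inter> lev G r)"
        by (subst nn_integral_indicator) (auto simp: lev_def)
      \<comment> \<open>Writing the measure as an integral over \<open>t\<close> makes the claim
        pointwise: a positive \<open>t\<close> below the measure of the intersection is below both
        measures, so the rearrangements at \<open>t\<close> are at least \<open>s\<close> and
        \<open>r\<close>.\<close>
      also have "\<dots> = (\<integral>\<^sup>+ t. K (emeasure M (lev F s \<inter> lev G r)) t \<partial>lborel)" by (simp add: K)
      also have "\<dots> \<le> (\<integral>\<^sup>+ t. indicator {0<..} t * (L (rearrangement M f t) s * L (rearrangement M g t) r) \<partial>lborel)"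
      proof (rule nn_integral_mono)
        fix t :: real
        show "K (emeasure M (lev F s \<inter> lev G r)) t \<le>
           indicator {0<..} t * (L (rearrangement M f t) s * L (rearrangement M g t) r)"
        proof (cases "0 < t \<and> ennreal t < emeasure M (lev F s \<inter> lev G r)")
          case t: True
          have "emeasure M (lev F s \<inter> lev G r) \<le> emeasure M (lev F s)"
               "emeasure M (lev F s \<inter> lev G r) \<le> emeasure M (lev G r)"
            by (auto intro!: emeasure_mono simp: lev_def)
          then have "ennreal s \<le> rearrangement M f t" "ennreal r \<le> rearrangement M g t"
            using t f g by (auto intro!: le_rearrangement simp: lev_def F_def G_def intro: less_le_trans)
          then show ?thesis using t True by (simp add: K_eq L_eq)
        qed (auto simp: K_eq)
      qed
      finally show ?thesis by (simp add: z)
    qed (auto simp: K_eq z)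
  qed
  also have "\<dots> = (\<integral>\<^sup>+ t. \<integral>\<^sup>+ z. indicator {0<..} t * (L (rearrangement M f t) (fst z) * L (rearrangement M g t) (snd z))
       \<partial>(lborel \<Otimes>\<^sub>M lborel) \<partial>lborel)"
    unfolding L_eq by (intro LP.Fubini') measurable
  also have "\<dots> = (\<integral>\<^sup>+ t. indicator {0<..} t * (rearrangement M f t * rearrangement M g t) \<partial>lborel)"
    by (subst nn_integral_cmult) (auto simp: nn_integral_lborel_prod_times L)
  finally show ?thesis .
qed

section \<open>Near-extremal functions on dyadic scales\<close>

lemma dyadic_interval:
  fixes a t :: real
  assumes "0 < a" "a \<le> t"
  shows "\<exists>j. a * 2 ^ j \<le> t \<and> t < a * 2 ^ Suc j"
proof -
  define n where "n = (LEAST n. t < a * 2 ^ n)"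
  obtain m where "t / a < 2 ^ m" using real_arch_pow[of 2 "t / a"] by auto
  then have "t < a * 2 ^ m" using assms by (simp add: field_simps)
  then have n: "t < a * 2 ^ n" unfolding n_def by (rule LeastI)
  with assms have "n \<noteq> 0" by (intro notI) auto
  then obtain j where j: "n = Suc j" by (cases n) auto
  then have "\<not> t < a * 2 ^ j" using not_less_Least[of j "\<lambda>n. t < a * 2 ^ n"] by (simp add: n_def)
  then show ?thesis using n j by (intro exI[of _ j]) auto
qed

text \<open>On sets \<open>A j\<close> of measure \<open>s j = a * 2 ^ j\<close> on which \<open>f\<close> is at least about \<open>f* (s j)\<close>, the
  function \<open>g = (SUP j. \<psi> (s j) * indicator (A j))\<close> satisfies \<open>g* \<le> \<psi>\<close> and comes within a constant
  factor of equality in the Hardy-Littlewood inequality. The truncation at \<open>N\<close> and the division by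
  2 make the threshold strictly smaller than \<open>f* (s j)\<close>, as \<open>|f| \<ge> f* (s j)\<close> may fail on
  every set of positive measure.\<close>

lemma rearrangement_test_function:
  fixes \<psi> :: "real \<Rightarrow> real" and N :: ennreal
  assumes na: "nonatomic M" and inf: "emeasure M (space M) = \<infinity>" and f: "f \<in> mfuns M"
    and \<psi>0: "\<And>t. 0 < t \<Longrightarrow> 0 \<le> \<psi> t" and \<psi>: "\<And>s t. 0 < s \<Longrightarrow> s \<le> t \<Longrightarrow> \<psi> t \<le> \<psi> s"
    and a: "0 < a" and N: "N < \<infinity>"
  shows "\<exists>g\<in>mfuns M. (\<forall>t>0. rearrangement M g t \<le> ennreal (\<psi> t)) \<and>
    (\<integral>\<^sup>+ t. indicator {2 * a..} t * (min N (rearrangement M f t / 2) * ennreal (\<psi> t)) \<partial>lborel)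
      \<le> 2 * (\<integral>\<^sup>+ x. ecmod (f x) * ecmod (g x) \<partial>M)"
proof -
  define F where "F = (\<lambda>x. ecmod (f x))"
  have [measurable]: "F \<in> borel_measurable M"
    using measurable_ecmod_mfuns[OF f] by (simp add: F_def)
  define s where "s j = a * 2 ^ j" for j :: nat
  have s0: "0 < s j" for j using a by (simp add: s_def)
  have sSuc: "s (Suc j) = 2 * s j" for j by (simp add: s_def)
  have s_mono: "incseq s" using a by (auto intro!: incseq_SucI simp: s_def)
  define \<Lambda> where "\<Lambda> t = min N (rearrangement M f t / 2)" for t
  have \<Lambda>: "\<Lambda> v \<le> \<Lambda> t" if "t \<le> v" for t v
    using rearrangement_antimono[OF that, of M f] unfolding \<Lambda>_def
    by (intro min.mono divide_right_mono_ennreal) auto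
  define B where "B j = {x \<in> space M. \<Lambda> (s j) \<le> F x}" for j
  have sB: "B j \<in> sets M" for j by (simp add: B_def)
  have incB: "incseq B"
    unfolding B_def using \<Lambda>[OF incseqD[OF s_mono]] by (fastforce simp: incseq_def intro: order_trans)
  have eB: "ennreal (s j) \<le> emeasure M (B j)" for j
  proof (cases "\<Lambda> (s j) = 0")
    \<comment> \<open>Here \<open>B j\<close> is the whole space, of infinite measure; the strict
      inequality used in the other case may fail.\<close>
    case True
    then show ?thesis using inf by (simp add: B_def)
  next
    case False
    have "\<Lambda> (s j) < rearrangement M f (s j)"
    proof (cases "rearrangement M f (s j)")
      case (real r)
      then have "0 < r" using False by (cases "r = 0") (auto simp: \<Lambda>_def)
      then have "rearrangement M f (s j) / 2 < rearrangement M f (s j)"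
        using real by (auto simp: divide_ennreal ennreal_less_iff simp flip: ennreal_numeral)
      then show ?thesis by (auto simp: \<Lambda>_def min_less_iff_disj)
    next
      case top
      then show ?thesis using N by (auto simp: \<Lambda>_def min_less_iff_disj)
    qed
    then have "ennreal (s j) < emeasure M {x \<in> space M. \<Lambda> (s j) < F x}"
      unfolding F_def by (rule emeasure_gt_if_less_rearrangement)
    also have "\<dots> \<le> emeasure M (B j)" by (rule emeasure_mono) (auto simp: B_def)
    finally show ?thesis by simp
  qed
  obtain A where A: "\<And>j. A j \<in> sets M" "\<And>j. A j \<subseteq> B j" "\<And>j. emeasure M (A j) = ennreal (s j)"
    and incA: "incseq A"
    using nonatomic_subset_chain[OF na sB incB eB s_mono less_imp_le[OF s0]] by auto
  note [measurable] = A(1)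
  define h where "h x = (SUP j. ennreal (\<psi> (s j)) * indicator (A j) x)" for x
  have [measurable]: "h \<in> borel_measurable M" unfolding h_def by measurable
  have h_le: "h x \<le> ennreal (\<psi> (s 0))" for x
    unfolding h_def
  proof (rule SUP_least)
    fix j
    have "\<psi> (s j) \<le> \<psi> (s 0)" using incseqD[OF s_mono, of 0 j] s0 by (intro \<psi>) auto
    then show "ennreal (\<psi> (s j)) * indicator (A j) x \<le> ennreal (\<psi> (s 0))"
      by (auto simp: indicator_def ennreal_leI)
  qed
  \<comment> \<open>As \<open>h\<close> is bounded by the finite value \<open>\<psi> (s 0)\<close>,
    \<open>enn2real\<close> loses nothing.\<close>
  define g where "g x = Some (complex_of_real (enn2real (h x)))" for x
  have g: "g \<in> mfuns M"
    unfolding mfuns_def g_def by (rule measurable_compose[OF _ measurable_Some_ecomplex]) measurable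
  have ecmod_g: "ecmod (g x) = h x" for x
    using le_less_trans[OF h_le[of x] ennreal_less_top] by (simp add: g_def)
  have g_le: "rearrangement M g t \<le> ennreal (\<psi> t)" if t: "0 < t" for t
  proof (rule rearrangement_le[OF \<psi>0[OF t]], unfold ecmod_g)
    show "emeasure M {x \<in> space M. ennreal (\<psi> t) < h x} \<le> ennreal t"
    proof (cases "a \<le> t")
      \<comment> \<open>Below the first scale \<open>s 0 = a\<close> the level set is empty.\<close>
      case False
      then have "\<psi> (s 0) \<le> \<psi> t" using t by (intro \<psi>) (auto simp: s_def)
      then have "h x \<le> ennreal (\<psi> t)" for x using h_le ennreal_leI order_trans by blast
      then show ?thesis by (simp add: not_less[symmetric])
    next
      case True
      then obtain j where j: "s j \<le> t" "t < s (Suc j)"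
        using dyadic_interval[OF a] by (auto simp: s_def)
      \<comment> \<open>Outside \<open>A j\<close> only terms of index above \<open>j\<close>
        survive; they belong to scales beyond \<open>t\<close> and so are at most
        \<open>\<psi> t\<close>.\<close>
      have "{x \<in> space M. ennreal (\<psi> t) < h x} \<subseteq> A j"
      proof (rule ccontr)
        assume "\<not> {x \<in> space M. ennreal (\<psi> t) < h x} \<subseteq> A j"
        then obtain x where x: "ennreal (\<psi> t) < h x" "x \<notin> A j" by auto
        have "h x \<le> ennreal (\<psi> t)"
          unfolding h_def
        proof (rule SUP_least)
          fix i
          show "ennreal (\<psi> (s i)) * indicator (A i) x \<le> ennreal (\<psi> t)"
          proof (cases "i \<le> j")
            case True
            then show ?thesis using x(2) incseqD[OF incA True] by (auto simp: indicator_def)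
          next
            case False
            then have "s (Suc j) \<le> s i" by (intro incseqD[OF s_mono]) simp
            then have "\<psi> (s i) \<le> \<psi> t" using j t by (intro \<psi>) auto
            then show ?thesis by (auto simp: indicator_def ennreal_leI)
          qed
        qed
        with x show False by simp
      qed
      then have "emeasure M {x \<in> space M. ennreal (\<psi> t) < h x} \<le> ennreal (s j)"
        using emeasure_mono[of _ "A j" M] A by metis
      also have "\<dots> \<le> ennreal t" using j by (simp add: ennreal_leI)
      finally show ?thesis .
    qed
  qed
  \<comment> \<open>By monotonicity \<open>c j\<close> bounds the integrand from above on
    \<open>{s (Suc j)..<s (Suc (Suc j))}\<close> and the product of the moduli from below on
    \<open>E j\<close>. That interval has length \<open>2 * s j\<close> while \<open>E j\<close> has
    measure \<open>s j\<close>, which gives the factor 2; the shift of index makes the integral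
    start at \<open>2 * a\<close>.\<close>
  define c where "c j = \<Lambda> (s (Suc j)) * ennreal (\<psi> (s (Suc j)))" for j
  define E where "E j = A (Suc j) - A j" for j
  have [measurable]: "E j \<in> sets M" for j by (simp add: E_def)
  have disj: "disjoint_family E"
    unfolding E_def using incA by (intro disjoint_family_Suc) (auto dest: incseq_SucD)
  have eE: "emeasure M (E j) = ennreal (s j)" for j
    unfolding E_def using A incseq_SucD[OF incA, of j] s0
    by (subst emeasure_Diff) (auto simp: ennreal_minus sSuc less_imp_le)
  have "(\<integral>\<^sup>+ t. indicator {2 * a..} t * (\<Lambda> t * ennreal (\<psi> t)) \<partial>lborel)
      \<le> (\<integral>\<^sup>+ t. (\<Sum>j. c j * indicator {s (Suc j)..<s (Suc (Suc j))} t) \<partial>lborel)"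
  proof (rule nn_integral_mono)
    fix t
    show "indicator {2 * a..} t * (\<Lambda> t * ennreal (\<psi> t))
        \<le> (\<Sum>j. c j * indicator {s (Suc j)..<s (Suc (Suc j))} t)"
    proof (cases "2 * a \<le> t")
      case True
      then obtain j where j: "s (Suc j) \<le> t" "t < s (Suc (Suc j))"
        using dyadic_interval[of "2 * a" t] a by (auto simp: s_def algebra_simps)
      have "indicator {2 * a..} t * (\<Lambda> t * ennreal (\<psi> t)) = \<Lambda> t * ennreal (\<psi> t)"
        using True by simp
      also have "\<dots> \<le> c j"
        unfolding c_def using j s0 by (intro mult_mono \<Lambda> ennreal_leI \<psi>) auto
      also have "\<dots> = (\<Sum>i\<in>{j}. c i * indicator {s (Suc i)..<s (Suc (Suc i))} t)"
        using j by simp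
      also have "\<dots> \<le> (\<Sum>j. c j * indicator {s (Suc j)..<s (Suc (Suc j))} t)"
        by (intro sum_le_suminf) auto
      finally show ?thesis .
    qed simp
  qed
  also have "\<dots> = (\<Sum>j. c j * ennreal (s (Suc j)))"
    using s0 by (subst nn_integral_suminf) (auto simp: nn_integral_cmult_indicator sSuc less_imp_le)
  also have "\<dots> = (\<Sum>j. 2 * (c j * ennreal (s j)))"
    by (simp add: sSuc ennreal_mult' mult.left_commute)
  also have "\<dots> = 2 * (\<Sum>j. c j * ennreal (s j))" by (rule ennreal_suminf_cmult)
  also have "(\<Sum>j. c j * ennreal (s j)) = (\<integral>\<^sup>+ x. (\<Sum>j. c j * indicator (E j) x) \<partial>M)"
    by (subst nn_integral_suminf) (auto simp: nn_integral_cmult_indicator eE)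
  also have "\<dots> \<le> (\<integral>\<^sup>+ x. ecmod (f x) * ecmod (g x) \<partial>M)"
  proof (rule nn_integral_mono)
    fix x
    show "(\<Sum>j. c j * indicator (E j) x) \<le> ecmod (f x) * ecmod (g x)"
    proof (cases "\<exists>j. x \<in> E j")
      case True
      then obtain j where j: "x \<in> E j" by blast
      then have x: "x \<in> A (Suc j)" by (simp add: E_def)
      have "\<Lambda> (s (Suc j)) \<le> ecmod (f x)" using x A(2) by (auto simp: B_def F_def)
      moreover have "ennreal (\<psi> (s (Suc j))) \<le> h x"
        unfolding h_def by (rule SUP_upper2[of "Suc j"]) (use x in auto)
      ultimately show ?thesis
        unfolding suminf_cmult_indicator[OF disj j] c_def ecmod_g by (intro mult_mono) auto
    qed (auto simp: indicator_def)
  qed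
  finally have "(\<integral>\<^sup>+ t. indicator {2 * a..} t * (\<Lambda> t * ennreal (\<psi> t)) \<partial>lborel)
      \<le> 2 * (\<integral>\<^sup>+ x. ecmod (f x) * ecmod (g x) \<partial>M)"
    by (simp add: mult_left_mono)
  then show ?thesis
    using g g_le unfolding \<Lambda>_def by blast
qed

section \<open>Bounds for the associate norm\<close>

text \<open>The integral is a supremum over simple functions below \<open>h\<close>, and a Lebesgue
  simple function becomes Borel when set to 0 on a null set. So \<open>h\<close> is arbitrary, which
  covers integrands with a factor \<open>\<psi>\<close> known only to be non-increasing.\<close>

lemma nn_integral_lebesgue_on_pos:
  fixes h :: "real \<Rightarrow> ennreal"
  shows "(\<integral>\<^sup>+ t. h t \<partial>lebesgue_on {0<..}) = (\<integral>\<^sup>+ t. indicator {0<..} t * h t \<partial>lborel)"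
proof -
  have "(\<integral>\<^sup>+ t. h t \<partial>lebesgue_on {0<..}) = (\<integral>\<^sup>+ t. h t * indicator {0<..} t \<partial>lebesgue)"
    by (rule nn_integral_restrict_space) (auto intro: sets_completionI_sets)
  then show ?thesis by (simp add: nn_integral_completion mult.commute)
qed

lemma borel_measurable_lebesgue_on: "h \<in> borel_measurable borel \<Longrightarrow> h \<in> borel_measurable (lebesgue_on S)"
  by (auto intro!: measurable_restrict_space1 measurable_completion)

lemma associate_norm_le:
  assumes sf: "sigma_finite_measure M" and \<phi>: "\<And>t. 0 < t \<Longrightarrow> 0 < (\<phi> t :: real)" and f: "f \<in> mfuns M"
  shows "associate_norm M (\<lambda>g. esssup (lebesgue_on {0<..}) (\<lambda>t. ennreal (\<phi> t) * rearrangement M g t)) f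
    \<le> (\<integral>\<^sup>+ t. ennreal (1 / \<phi> t) * rearrangement M f t \<partial>lebesgue_on {0<..})"
  unfolding associate_norm_def
proof (rule SUP_least)
  fix g
  assume "g \<in> {g \<in> mfuns M. esssup (lebesgue_on {0<..}) (\<lambda>t. ennreal (\<phi> t) * rearrangement M g t) \<le> 1}"
  then have g: "g \<in> mfuns M"
    and le: "esssup (lebesgue_on {0<..}) (\<lambda>t. ennreal (\<phi> t) * rearrangement M g t) \<le> 1" by auto
  have le_inverse: "rearrangement M g t \<le> ennreal (1 / \<phi> t)"
    if "0 < t" "ennreal (\<phi> t) * rearrangement M g t \<le> 1" for t
  proof (cases "rearrangement M g t")
    case (real r)
    then show ?thesis using that \<phi>[of t]
      by (auto simp: ennreal_le_1 field_simps simp flip: ennreal_mult intro!: ennreal_leI)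
  next
    case top
    then show ?thesis using that \<phi>[of t] by (auto simp: ennreal_mult_top top_unique)
  qed
  have "AE t in lebesgue_on {0<..}. ennreal (\<phi> t) * rearrangement M g t \<le>
      esssup (lebesgue_on {0<..}) (\<lambda>t. ennreal (\<phi> t) * rearrangement M g t)"
    by (rule esssup_AE)
  then have "AE t in lebesgue_on {0<..}. ennreal (\<phi> t) * rearrangement M g t \<le> 1"
    by eventually_elim (rule order_trans[OF _ le])
  then have ae: "AE t in lebesgue_on {0<..}. rearrangement M g t \<le> ennreal (1 / \<phi> t)"
    by (rule AE_mp) (auto intro!: AE_I2 le_inverse)
  have "(\<integral>\<^sup>+ x. ecmod (ectimes (f x) (g x)) \<partial>M) \<le>
      (\<integral>\<^sup>+ t. rearrangement M f t * rearrangement M g t \<partial>lebesgue_on {0<..})"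
    unfolding ecmod_ectimes nn_integral_lebesgue_on_pos by (rule Hardy_Littlewood_inequality[OF sf f g])
  also have "\<dots> \<le> (\<integral>\<^sup>+ t. ennreal (1 / \<phi> t) * rearrangement M f t \<partial>lebesgue_on {0<..})"
    using ae by (intro nn_integral_mono_AE) (auto elim!: eventually_mono simp: mult.commute intro: mult_left_mono)
  finally show "(\<integral>\<^sup>+ x. ecmod (ectimes (f x) (g x)) \<partial>M) \<le>
    (\<integral>\<^sup>+ t. ennreal (1 / \<phi> t) * rearrangement M f t \<partial>lebesgue_on {0<..})" .
qed

text \<open>These are the truncations of the test function lemma for
  \<open>a = 1 / real (Suc n)\<close> and \<open>N = of_nat n\<close>; the cutoff is its
  \<open>2 * a\<close>.\<close>

lemma le_SUP_truncation:
  fixes y :: ennreal and t :: real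
  assumes "0 < t"
  shows "y \<le> (SUP n. indicator {2 / real (Suc n)..} t * min (of_nat n) y)"
proof (rule dense_le)
  fix z assume z: "z < y"
  then have "z < top" by (simp add: order_less_le_trans)
  then obtain r where r: "z = ennreal r" "0 \<le> r" by (cases z) auto
  obtain n :: nat where n: "max r (2 / t) \<le> n" using real_arch_simple by blast
  then have "2 / real (Suc n) \<le> t" using assms by (simp add: field_simps)
  moreover have "z \<le> of_nat n"
    using n r by (simp add: ennreal_of_nat_eq_real_of_nat ennreal_leI)
  ultimately have "z \<le> indicator {2 / real (Suc n)..} t * min (of_nat n) y"
    using z by simp
  then show "z \<le> (SUP n. indicator {2 / real (Suc n)..} t * min (of_nat n) y)"
    by (rule SUP_upper2[rotated]) simp
qed

text \<open>With \<open>\<psi> = 1 / (C * u)\<close> one has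
  \<open>\<psi> \<le> 1 / \<phi> \<le> K * \<psi>\<close> on the positive half-line. The first
  inequality makes the test functions admissible in the associate norm, the second returns from
  \<psi> to the weight; monotone convergence removes the truncation.\<close>

lemma le_associate_norm:
  assumes na: "nonatomic M" and inf: "emeasure M (space M) = \<infinity>"
    and \<phi>_meas: "\<phi> \<in> borel_measurable (lebesgue_on {0<..})" and \<phi>: "\<And>t. 0 < t \<Longrightarrow> 0 < (\<phi> t :: real)"
    and u: "mono_on {0<..} u" "approx_on_pos \<phi> u"
  shows "\<exists>C>0. \<forall>f\<in>mfuns M. (\<integral>\<^sup>+ t. ennreal (1 / \<phi> t) * rearrangement M f t \<partial>lebesgue_on {0<..}) \<le>
    ennreal C * associate_norm M (\<lambda>g. esssup (lebesgue_on {0<..}) (\<lambda>t. ennreal (\<phi> t) * rearrangement M g t)) f"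
proof -
  obtain c C where cC: "0 < c" "0 < C" "\<And>t. 0 < t \<Longrightarrow> c * u t \<le> \<phi> t" "\<And>t. 0 < t \<Longrightarrow> \<phi> t \<le> C * u t"
    using u(2) by (auto simp: approx_on_pos_def)
  have u0: "0 < u t" if "0 < t" for t
    using less_le_trans[OF \<phi> cC(4)] that cC(2) by (auto simp: zero_less_mult_iff)
  define \<psi> where "\<psi> t = 1 / (C * u t)" for t
  define K where "K = C / c"
  have K: "0 < K" using cC by (simp add: K_def)
  have \<psi>0: "0 \<le> \<psi> t" if "0 < t" for t using u0[OF that] cC by (simp add: \<psi>_def)
  have \<psi>: "\<psi> t \<le> \<psi> s" if "0 < s" "s \<le> t" for s t
    using u0[OF that(1)] mono_onD[OF u(1), of s t] that cC
    by (auto simp: \<psi>_def intro!: divide_left_mono mult_pos_pos)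
  have \<phi>\<psi>: "\<phi> t * \<psi> t \<le> 1" if "0 < t" for t
    using u0[OF that] cC(2) cC(4)[OF that] by (simp add: \<psi>_def)
  have K\<psi>: "1 / (K * \<phi> t) \<le> \<psi> t" if "0 < t" for t
    using u0[OF that] cC(1,2) cC(3)[OF that] \<phi>[OF that] by (simp add: \<psi>_def K_def field_simps)
  define w where "w t = ennreal (1 / \<phi> t)" for t
  have w_meas [measurable]: "w \<in> borel_measurable (lebesgue_on {0<..})"
    unfolding w_def using \<phi>_meas by measurable
  have w_le: "w t \<le> ennreal K * ennreal (\<psi> t)" if "0 < t" for t
  proof -
    have "1 / \<phi> t \<le> K * \<psi> t" using K\<psi>[OF that] K \<phi>[OF that] by (simp add: field_simps)
    then show ?thesis using K \<psi>0[OF that] by (simp add: w_def ennreal_leI flip: ennreal_mult)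
  qed
  \<comment> \<open>In \<open>4 * K\<close>, one factor 2 is the loss of the test function and the
    other undoes the halving of the rearrangement.\<close>
  have main: "(\<integral>\<^sup>+ t. w t * rearrangement M f t \<partial>lebesgue_on {0<..}) \<le> ennreal (4 * K) *
      associate_norm M (\<lambda>g. esssup (lebesgue_on {0<..}) (\<lambda>t. ennreal (\<phi> t) * rearrangement M g t)) f"
    (is "_ \<le> _ * ?A") if f: "f \<in> mfuns M" for f
  proof -
    have [measurable]: "rearrangement M g \<in> borel_measurable (lebesgue_on {0<..})" for g
      by (intro borel_measurable_lebesgue_on measurable_rearrangement)
    define \<Phi> where "\<Phi> n t = indicator {2 / real (Suc n)..} t * min (of_nat n) (rearrangement M f t / 2)" for n t
    have [measurable]: "\<Phi> n \<in> borel_measurable (lebesgue_on {0<..})" for n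
      unfolding \<Phi>_def by (intro borel_measurable_lebesgue_on) measurable
    have le: "(\<integral>\<^sup>+ t. \<Phi> n t * w t \<partial>lebesgue_on {0<..}) \<le> ennreal (2 * K) * ?A" for n
    proof -
      have "0 < 1 / real (Suc n)" "of_nat n < (\<infinity> :: ennreal)"
        by (auto simp: of_nat_less_top)
      from rearrangement_test_function[where \<psi> = \<psi>, OF na inf f \<psi>0 \<psi> this]
      obtain g where g: "g \<in> mfuns M" "\<And>t. 0 < t \<Longrightarrow> rearrangement M g t \<le> ennreal (\<psi> t)"
        and int: "(\<integral>\<^sup>+ t. indicator {2 * (1 / real (Suc n))..} t *
            (min (of_nat n) (rearrangement M f t / 2) * ennreal (\<psi> t)) \<partial>lborel)
          \<le> 2 * (\<integral>\<^sup>+ x. ecmod (f x) * ecmod (g x) \<partial>M)"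
        by blast
      have "esssup (lebesgue_on {0<..}) (\<lambda>t. ennreal (\<phi> t) * rearrangement M g t) \<le> 1"
      proof (rule esssup_I)
        \<comment> \<open>Measurability matters: \<open>esssup\<close> of a non-measurable function
          is \<open>top\<close> by convention.\<close>
        show "(\<lambda>t. ennreal (\<phi> t) * rearrangement M g t) \<in> borel_measurable (lebesgue_on {0<..})"
          using \<phi>_meas by measurable
        show "AE t in lebesgue_on {0<..}. ennreal (\<phi> t) * rearrangement M g t \<le> 1"
        proof (rule AE_I2)
          fix t :: real assume "t \<in> space (lebesgue_on {0<..})"
          then have t: "0 < t" by simp
          have "ennreal (\<phi> t) * rearrangement M g t \<le> ennreal (\<phi> t) * ennreal (\<psi> t)"
            using g(2)[OF t] by (rule mult_left_mono) simp
          also have "\<dots> \<le> 1"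
            using \<phi>\<psi>[OF t] \<phi>[OF t] \<psi>0[OF t] by (simp add: ennreal_le_1 flip: ennreal_mult)
          finally show "ennreal (\<phi> t) * rearrangement M g t \<le> 1" .
        qed
      qed
      then have "(\<integral>\<^sup>+ x. ecmod (ectimes (f x) (g x)) \<partial>M) \<le> ?A"
        unfolding associate_norm_def using g(1) by (intro SUP_upper) simp
      then have A: "(\<integral>\<^sup>+ x. ecmod (f x) * ecmod (g x) \<partial>M) \<le> ?A"
        by (simp only: ecmod_ectimes)
      \<comment> \<open>\<open>K\<close> leaves the integral while the integrand is still expressed
        by the measurable \<phi>; only afterwards does \<psi> replace
        \<open>1 / (K * \<phi> t)\<close>.\<close>
      have eq: "w t = ennreal K * ennreal (1 / (K * \<phi> t))" if "0 < t" for t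
        using K \<phi>[OF that] by (simp add: w_def flip: ennreal_mult)
      have "(\<integral>\<^sup>+ t. \<Phi> n t * w t \<partial>lebesgue_on {0<..}) =
          (\<integral>\<^sup>+ t. ennreal K * (\<Phi> n t * ennreal (1 / (K * \<phi> t))) \<partial>lebesgue_on {0<..})"
        by (intro nn_integral_cong) (simp add: eq mult_ac)
      also have "\<dots> = ennreal K * (\<integral>\<^sup>+ t. \<Phi> n t * ennreal (1 / (K * \<phi> t)) \<partial>lebesgue_on {0<..})"
        using \<phi>_meas by (intro nn_integral_cmult) measurable
      also have "\<dots> \<le> ennreal K * (2 * ?A)"
      proof (rule mult_left_mono)
        have "(\<integral>\<^sup>+ t. \<Phi> n t * ennreal (1 / (K * \<phi> t)) \<partial>lebesgue_on {0<..}) \<le>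
            (\<integral>\<^sup>+ t. \<Phi> n t * ennreal (\<psi> t) \<partial>lebesgue_on {0<..})"
          by (intro nn_integral_mono mult_left_mono ennreal_leI K\<psi>) auto
        also have "\<dots> \<le> (\<integral>\<^sup>+ t. indicator {2 * (1 / real (Suc n))..} t *
              (min (of_nat n) (rearrangement M f t / 2) * ennreal (\<psi> t)) \<partial>lborel)"
          unfolding nn_integral_lebesgue_on_pos
          by (intro nn_integral_mono) (auto simp: \<Phi>_def indicator_def)
        also have "\<dots> \<le> 2 * ?A" using int A by (meson mult_left_mono order_trans zero_le)
        finally show "(\<integral>\<^sup>+ t. \<Phi> n t * ennreal (1 / (K * \<phi> t)) \<partial>lebesgue_on {0<..}) \<le> 2 * ?A" .
      qed simp
      also have "\<dots> = ennreal (2 * K) * ?A"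
        using K by (simp add: ennreal_mult mult_ac)
      finally show ?thesis .
    qed
    have incr: "incseq (\<lambda>n t. \<Phi> n t * w t)"
    proof (intro incseq_SucI le_funI mult_right_mono)
      fix n t
      have "2 / real (Suc (Suc n)) \<le> 2 / real (Suc n)" by (simp add: field_simps)
      moreover have "(of_nat n :: ennreal) \<le> of_nat (Suc n)" by (simp del: of_nat_Suc)
      ultimately show "\<Phi> n t \<le> \<Phi> (Suc n) t"
        unfolding \<Phi>_def by (intro mult_mono min.mono) (auto simp: indicator_def simp del: of_nat_Suc)
    qed simp
    have "(\<integral>\<^sup>+ t. w t * rearrangement M f t \<partial>lebesgue_on {0<..}) \<le>
        (\<integral>\<^sup>+ t. 2 * (SUP n. \<Phi> n t * w t) \<partial>lebesgue_on {0<..})"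
    proof (rule nn_integral_mono)
      fix t :: real assume "t \<in> space (lebesgue_on {0<..})"
      then have "rearrangement M f t / 2 \<le> (SUP n. \<Phi> n t)"
        unfolding \<Phi>_def by (intro le_SUP_truncation) simp
      then have "rearrangement M f t / 2 * w t \<le> (SUP n. \<Phi> n t) * w t"
        by (rule mult_right_mono) simp
      then have "rearrangement M f t / 2 * w t \<le> (SUP n. \<Phi> n t * w t)"
        by (simp only: SUP_mult_right_ennreal)
      moreover have "rearrangement M f t = 2 * (rearrangement M f t / 2)"
        by (cases "rearrangement M f t")
          (auto simp: divide_ennreal ennreal_mult[symmetric] ennreal_top_divide simp flip: ennreal_numeral)
      then have "w t * rearrangement M f t = 2 * (rearrangement M f t / 2 * w t)"
        by (metis mult.assoc mult.commute)
      ultimately show "w t * rearrangement M f t \<le> 2 * (SUP n. \<Phi> n t * w t)"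
        by (simp add: mult_left_mono)
    qed
    also have "\<dots> = 2 * (\<integral>\<^sup>+ t. (SUP n. \<Phi> n t * w t) \<partial>lebesgue_on {0<..})"
      by (intro nn_integral_cmult) measurable
    also have "\<dots> = 2 * (SUP n. \<integral>\<^sup>+ t. \<Phi> n t * w t \<partial>lebesgue_on {0<..})"
      using incr by (subst nn_integral_monotone_convergence_SUP) auto
    also have "\<dots> \<le> 2 * (ennreal (2 * K) * ?A)"
      by (intro mult_left_mono SUP_least le) auto
    also have "\<dots> = ennreal (4 * K) * ?A"
    proof -
      have "2 * ennreal (2 * K) = ennreal (4 * K)"
        using K by (simp add: ennreal_mult[symmetric] flip: ennreal_numeral)
      then show ?thesis by (simp flip: mult.assoc)
    qed
    finally show ?thesis .
  qed
  then show ?thesis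
    using K unfolding w_def by (intro exI[of _ "4 * K"]) auto
qed

section \<open>Conjugate exponents and conclusion\<close>

text \<open>This turns the power of \<open>t\<close> in the norm with second exponent 1 into the
  reciprocal of the one in \<phi>.\<close>

lemma enn2real_inverse_conj_exponent:
  assumes "1 \<le> p"
  shows "enn2real (1 / conj_exponent p) = 1 - enn2real (1 / p)"
proof (cases p)
  case (real r)
  then have r: "1 \<le> r" using assms by (simp add: ennreal_1[symmetric] del: ennreal_1)
  show ?thesis
  proof (cases "r = 1")
    case False
    then have "1 < r" using r by simp
    moreover have "p - 1 = ennreal (r - 1)"
      using real r by (simp add: ennreal_minus flip: ennreal_1)
    ultimately have "conj_exponent p = ennreal (r / (r - 1))"
      using real by (auto simp: conj_exponent_def divide_ennreal ennreal_eq_1)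
    then show ?thesis
      using real \<open>1 < r\<close> by (simp add: divide_ennreal field_simps flip: ennreal_1)
  qed (use real in \<open>auto simp: conj_exponent_def\<close>)
qed (auto simp: conj_exponent_def)

theorem theorem3p31:
  fixes M :: "'a measure" and p :: ennreal and b :: "real \<Rightarrow> real"
  assumes "sigma_finite_measure M"
    and "nonatomic M"
    and "emeasure M (space M) = \<infinity>"
    and "1 \<le> p"
    and "slowly_varying b"
    and "p = \<infinity> \<Longrightarrow> mono_on {0<..} b"
  shows "equivalent_spaces M
           (associate_norm M (LK_norm M p \<infinity> b))
           (LK_norm M (conj_exponent p) 1 (\<lambda>t. 1 / b t))"
proof -
  define \<alpha> where "\<alpha> = enn2real (1 / p)"
  define \<phi> where "\<phi> t = t powr \<alpha> * b t" for t
  have b: "b \<in> borel_measurable (lebesgue_on {0<..})" "\<And>t. 0 < t \<Longrightarrow> 0 < b t"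
    using assms(5) by (auto simp: slowly_varying_def)
  have \<phi>: "0 < \<phi> t" if "0 < t" for t using b(2) that by (simp add: \<phi>_def)
  have "(\<lambda>t. t powr \<alpha>) \<in> borel_measurable (lebesgue_on {0<..})"
    by (intro borel_measurable_lebesgue_on) measurable
  then have \<phi>_meas: "\<phi> \<in> borel_measurable (lebesgue_on {0<..})"
    unfolding \<phi>_def using b(1) by measurable
  have "\<exists>u. mono_on {0<..} u \<and> approx_on_pos \<phi> u"
  proof (cases "p = \<infinity>")
    \<comment> \<open>Now \<open>\<alpha> = 0\<close>, whereas slow variation provides monotone
      equivalents only for positive exponents; the monotonicity of \<open>b\<close> takes
      over.\<close>
    case True
    then have "\<phi> t = b t" if "0 < t" for t using that by (simp add: \<phi>_def \<alpha>_def)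
    then have "approx_on_pos \<phi> b"
      unfolding approx_on_pos_def by (intro exI[of _ 1] conjI) auto
    then show ?thesis using assms(6)[OF True] by blast
  next
    case False
    with assms(4) obtain r where r: "p = ennreal r" "1 \<le> r"
      by (cases p) (auto simp: ennreal_1[symmetric] simp del: ennreal_1)
    then have "0 < \<alpha>" by (simp add: \<alpha>_def divide_ennreal flip: ennreal_1)
    then have "\<exists>u. mono_on {0<..} u \<and> approx_on_pos (\<lambda>t. t powr \<alpha> * b t) u"
      using assms(5) unfolding slowly_varying_def by blast
    then show ?thesis by (simp add: \<phi>_def[abs_def])
  qed
  then obtain u where u: "mono_on {0<..} u" "approx_on_pos \<phi> u" by blast
  have X: "LK_norm M p \<infinity> b =
      (\<lambda>g. esssup (lebesgue_on {0<..}) (\<lambda>t. ennreal (\<phi> t) * rearrangement M g t))"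
    by (simp add: LK_norm_def Lq_norm_def \<phi>_def \<alpha>_def fun_eq_iff)
  have powr_1: "ennreal_powr x 1 = x" for x
    by (cases x) (auto simp: ennreal_powr_def)
  have Y: "LK_norm M (conj_exponent p) 1 (\<lambda>t. 1 / b t) f =
      (\<integral>\<^sup>+ t. ennreal (1 / \<phi> t) * rearrangement M f t \<partial>lebesgue_on {0<..})" for f
  proof -
    have "LK_norm M (conj_exponent p) 1 (\<lambda>t. 1 / b t) f =
        (\<integral>\<^sup>+ t. ennreal (t powr (- \<alpha>) * (1 / b t)) * rearrangement M f t \<partial>lebesgue_on {0<..})"
      using enn2real_inverse_conj_exponent[OF assms(4)]
      by (simp add: LK_norm_def Lq_norm_def powr_1 \<alpha>_def)
    also have "\<dots> = (\<integral>\<^sup>+ t. ennreal (1 / \<phi> t) * rearrangement M f t \<partial>lebesgue_on {0<..})"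
      by (intro nn_integral_cong) (simp add: \<phi>_def powr_minus_divide)
    finally show ?thesis .
  qed
  let ?N1 = "associate_norm M (LK_norm M p \<infinity> b)"
  let ?N2 = "LK_norm M (conj_exponent p) 1 (\<lambda>t. 1 / b t)"
  have le: "?N1 f \<le> ?N2 f" if "f \<in> mfuns M" for f
    unfolding X Y using assms(1) \<phi> that by (rule associate_norm_le)
  obtain C where C: "0 < C" "\<And>f. f \<in> mfuns M \<Longrightarrow> ?N2 f \<le> ennreal C * ?N1 f"
    using le_associate_norm[OF assms(2,3) \<phi>_meas \<phi> u] unfolding X Y by blast
  \<comment> \<open>One constant has to serve both directions, and \<open>?N1 f \<le> ?N2 f\<close>
    holds with constant 1.\<close>
  define D where "D = max 1 C"
  have D: "1 \<le> ennreal D" "ennreal C \<le> ennreal D" by (auto simp: D_def ennreal_leI simp flip: ennreal_1)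
  have bounds: "?N1 f \<le> ennreal D * ?N2 f" "?N2 f \<le> ennreal D * ?N1 f" if "f \<in> mfuns M" for f
    using le[OF that] C(2)[OF that] mult_right_mono[OF D(1), of "?N2 f"] mult_right_mono[OF D(2), of "?N1 f"]
    by (auto intro: order_trans)
  have "?N1 f < \<infinity> \<longleftrightarrow> ?N2 f < \<infinity>" if "f \<in> mfuns M" for f
    using le[OF that] C(2)[OF that] by (auto simp: ennreal_mult_less_top elim: le_less_trans)
  then have "space_of M ?N1 = space_of M ?N2" by (auto simp: space_of_def)
  moreover have "0 < D" by (simp add: D_def)
  ultimately show ?thesis unfolding equivalent_spaces_def using bounds by blast
qed

end
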